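(* Let $T>0$ and let $a_{mn}=\int_{\mathbb R}\psi_m(v)\psi_n(v)\,dv$ for $m,n\in\mathbb N$, where $\psi_m$ are the asymmetric Hermite functions with reference temperature $T$. If $m+n$ is odd, then $a_{mn}=0$. Otherwise, writing the pair of indices as $(m-l,m+l)$ with integers $m\ge 0$ and $-m\le l\le m$, $$a_{m-l,\,m+l}=(-1)^l\, T^{-\frac12}\,2^{-2m-\frac12}\,\frac{(2m)!}{m!\,\sqrt{(m-l)!\,(m+l)!}}.$$
   Context: $\mathbb N=\{0,1,2,\dots\}$. $H_m$ denotes the (physicists') Hermite polynomial of degree $m$, $H_m(x)=(-1)^m e^{x^2}\frac{d^m}{dx^m}e^{-x^2}$, orthogonal with respect to the weight $e^{-x^2}$. For a fixed $T>0$ the asymmetric Hermite functions are $$\psi_m(v)=e^{-v^2/T}\,T^{-\frac12}\,(2^m m!\sqrt{\pi})^{-\frac12}\,H_m(v/\sqrt T),\qquad m\in\mathbb N.$$ *)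

theory Defs
  imports "HOL-Analysis.Analysis"
begin

text \<open>Physicists' Hermite polynomials, as real functions, by the Rodrigues formula.\<close>

definition hermite :: "nat \<Rightarrow> real \<Rightarrow> real" where
  "hermite m x = (-1) ^ m * exp (x\<^sup>2) * (deriv ^^ m) (\<lambda>y. exp (- (y\<^sup>2))) x"

definition asym_hermite :: "real \<Rightarrow> nat \<Rightarrow> real \<Rightarrow> real" where
  "asym_hermite T m v =
     exp (- (v\<^sup>2) / T) * T powr (-1/2) * (2 ^ m * fact m * sqrt pi) powr (-1/2)
       * hermite m (v / sqrt T)"

definition hermite_overlap :: "real \<Rightarrow> nat \<Rightarrow> nat \<Rightarrow> real" where
  "hermite_overlap T m n = (\<integral>v. asym_hermite T m v * asym_hermite T n v \<partial>lborel)"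

end

theory Submission
  imports Defs "HOL-Probability.Distributions" "HOL-Computational_Algebra.Polynomial"
begin

text \<open>With \<open>g(x) = exp(-x\<^sup>2)\<close>, a rescaling turns the overlap of \<open>\<psi>\<^sub>m\<close> and \<open>\<psi>\<^sub>n\<close> into
  \<open>\<integral> H\<^sub>m H\<^sub>n g\<^sup>2\<close>, and \<open>g\<^sup>2\<close> is, up to the factor \<open>sqrt (\<pi>/2)\<close>, the centred normal density of
  standard deviation \<open>1/2\<close>. Write \<open>\<langle>p\<rangle>\<close> for the mean of \<open>p\<close> under that density.
  As \<open>H\<^sub>m g\<close> is up to sign the \<open>m\<close>-th derivative of \<open>g\<close>, integration by parts gives
  \<open>\<langle>H\<^bsub>m+1\<^esub> H\<^sub>n\<rangle> = - \<langle>H\<^sub>m H\<^bsub>n+1\<^esub>\<rangle>\<close>, which reduces everything to \<open>\<langle>H\<^bsub>m+n\<^esub>\<rangle>\<close>;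
  the three-term recurrence then yields \<open>\<langle>H\<^bsub>n+2\<^esub>\<rangle> = - (n+1) \<langle>H\<^sub>n\<rangle>\<close>.\<close>

section \<open>Hermite polynomials as formal polynomials\<close>

primrec hermite_poly :: "nat \<Rightarrow> real poly" where
  "hermite_poly 0 = 1"
| "hermite_poly (Suc n) = [:0, 2:] * hermite_poly n - pderiv (hermite_poly n)"

text \<open>Differentiating \<open>p(x) exp(-x^2)\<close> replaces \<open>p\<close> by
  \<open>p' - 2xp\<close>; the recursion of \<open>hermite_poly\<close> is this map with the sign
  flipped, hence the factor \<open>(-1) ^ m\<close>.\<close>

lemma deriv_funpow_gaussian:
  "(deriv ^^ m) (\<lambda>y. exp (- (y\<^sup>2))) =
     (\<lambda>x::real. (-1) ^ m * poly (hermite_poly m) x * exp (- (x\<^sup>2)))"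
proof (induction m)
  case 0
  show ?case by simp
next
  case (Suc m)
  have "deriv (\<lambda>x. (-1) ^ m * poly (hermite_poly m) x * exp (- (x\<^sup>2))) x =
      (-1) ^ Suc m * poly (hermite_poly (Suc m)) x * exp (- (x\<^sup>2))" for x :: real
    by (rule DERIV_imp_deriv)
       (auto intro!: derivative_eq_intros poly_DERIV simp: algebra_simps)
  then show ?case by (simp add: Suc)
qed

lemma hermite_eq_poly: "hermite m x = poly (hermite_poly m) x"
proof -
  have "hermite m x = ((-1) ^ m * (-1) ^ m) * (exp (x\<^sup>2) * exp (- (x\<^sup>2))) * poly (hermite_poly m) x"
    by (simp add: hermite_def deriv_funpow_gaussian)
  also have "\<dots> = poly (hermite_poly m) x"
    by (simp flip: power_add exp_add)
  finally show ?thesis .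
qed

text \<open>Differentiate the recursion: by induction \<open>H_(n+1)'\<close> is a multiple of
  \<open>H_n\<close>, so the remaining terms reassemble into
  \<open>2x H_n - H_n' = H_(n+1)\<close>.\<close>

lemma pderiv_hermite_poly:
  "pderiv (hermite_poly (Suc n)) = smult (2 * (real n + 1)) (hermite_poly n)"
proof (induction n)
  case 0
  show ?case by (simp add: pderiv_pCons)
next
  case (Suc n)
  have "pderiv (hermite_poly (Suc (Suc n))) =
      [:2:] * hermite_poly (Suc n) + [:0, 2:] * pderiv (hermite_poly (Suc n))
        - pderiv (pderiv (hermite_poly (Suc n)))"
    by (subst hermite_poly.simps(2)) (simp add: pderiv_diff pderiv_mult pderiv_pCons pderiv_smult del: hermite_poly.simps)
  also have "\<dots> = [:2:] * hermite_poly (Suc n) +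
      smult (2 * (real n + 1)) ([:0, 2:] * hermite_poly n - pderiv (hermite_poly n))"
    unfolding Suc by (simp add: pderiv_smult smult_diff_right)
  also have "\<dots> = smult (2 + 2 * (real n + 1)) (hermite_poly (Suc n))"
    by (simp only: hermite_poly.simps(2)[symmetric] smult_add_left) simp
  finally show ?case by (simp add: algebra_simps del: hermite_poly.simps)
qed

lemma hermite_poly_rec:
  "hermite_poly (Suc (Suc n)) =
     [:0, 2:] * hermite_poly (Suc n) - smult (2 * (real n + 1)) (hermite_poly n)"
  by (subst hermite_poly.simps(2)) (simp only: pderiv_hermite_poly)

section \<open>Polynomial moments of the normal density\<close>

definition gauss_mean :: "real poly \<Rightarrow> real" where
  "gauss_mean p = (\<integral>x. poly p x * normal_density 0 (1/2) x \<partial>lborel)"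

lemma integrable_monomial_gauss:
  "integrable lborel (\<lambda>x::real. x ^ k * normal_density 0 (1/2) x)"
  using integrable_normal_moment[of "1/2" 0 k] by (simp add: mult.commute)

lemma integrable_poly_gauss: "integrable lborel (\<lambda>x. poly p x * normal_density 0 (1/2) x)"
proof -
  have "integrable lborel
      (\<lambda>x. \<Sum>i\<le>degree p. coeff p i * (x ^ i * normal_density 0 (1/2) x))"
    by (intro Bochner_Integration.integrable_sum integrable_mult_right integrable_monomial_gauss)
  then show ?thesis
    by (simp add: poly_altdef sum_distrib_right mult.assoc)
qed

lemma gauss_mean_add: "gauss_mean (p + q) = gauss_mean p + gauss_mean q"
  unfolding gauss_mean_def
  by (subst Bochner_Integration.integral_add[symmetric])
     (auto intro!: integrable_poly_gauss simp: algebra_simps)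

lemma gauss_mean_smult: "gauss_mean (smult c p) = c * gauss_mean p"
  unfolding gauss_mean_def by (simp add: mult.assoc)

lemma gauss_mean_uminus: "gauss_mean (- p) = - gauss_mean p"
  using gauss_mean_smult[of "-1" p] by simp

lemma gauss_mean_diff: "gauss_mean (p - q) = gauss_mean p - gauss_mean q"
  using gauss_mean_add[of p "- q"] by (simp add: gauss_mean_uminus)

lemma gauss_mean_sum: "gauss_mean (\<Sum>i\<in>A. f i) = (\<Sum>i\<in>A. gauss_mean (f i))"
proof -
  have "gauss_mean 0 = 0" by (simp add: gauss_mean_def)
  then show ?thesis
    by (induction A rule: infinite_finite_induct) (auto simp: gauss_mean_add)
qed

lemma gauss_mean_1: "gauss_mean 1 = 1"
  by (simp add: gauss_mean_def)

lemma gauss_mean_monom: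
  "gauss_mean (monom c k) = c * (\<integral>x. normal_density 0 (1/2) x * x ^ k \<partial>lborel)"
  unfolding gauss_mean_def by (simp add: poly_monom mult_ac)

lemma gauss_mean_monom_odd: "gauss_mean (monom c (2 * k + 1)) = 0"
  using integral_normal_moment_odd[of "1/2" 0 k] by (simp add: gauss_mean_monom)

text \<open>The base 8 is \<open>2 / s^2\<close> for the standard deviation
  \<open>s = 1/2\<close>.\<close>

lemma gauss_mean_monom_even: "gauss_mean (monom c (2 * k)) = c * (fact (2 * k) / (8 ^ k * fact k))"
  using integral_normal_moment_even[of "1/2" 0 k]
  by (simp add: gauss_mean_monom power2_eq_square)

text \<open>Integration by parts against the density, whose derivative is \<open>-4x\<close> times itself.\<close>

lemma gauss_mean_pderiv: "gauss_mean (pderiv p) = gauss_mean ([:0, 4:] * p)"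
proof -
  \<comment> \<open>Both sides are linear in \<open>p\<close>, so comparing known moments of
    monomials suffices and no boundary terms arise.\<close>
  have monom: "gauss_mean (pderiv (monom c k)) = gauss_mean ([:0, 4:] * monom c k)" for c k
  proof -
    have *: "[:0, 4:] * monom c k = monom (4 * c) (Suc k)"
      by (simp add: monom_Suc smult_monom)
    show ?thesis
    proof (cases "even k")
      case True
      then obtain j where j: "k = 2 * j" by (elim evenE)
      \<comment> \<open>For \<open>k = 0\<close> the truncated exponent \<open>k - 1\<close> is 0,
        which is even, but the coefficient vanishes.\<close>
      have "gauss_mean (monom (of_nat k * c) (k - 1)) = 0"
        using gauss_mean_monom_odd[of "of_nat k * c" "j - 1"] j
        by (cases j) (auto simp: gauss_mean_def)
      moreover have "gauss_mean (monom (4 * c) (Suc k)) = 0"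
        using gauss_mean_monom_odd[of "4 * c" j] j by simp
      ultimately show ?thesis by (simp only: * pderiv_monom)
    next
      case False
      then obtain j where j: "k = 2 * j + 1" by (elim oddE)
      have "gauss_mean (monom (of_nat k * c) (k - 1)) = of_nat k * c * (fact (2 * j) / (8 ^ j * fact j))"
        using gauss_mean_monom_even[of "of_nat k * c" j] j by simp
      \<comment> \<open>The even moments satisfy \<open>4 M_(2j+2) = (2j+1) M_(2j)\<close>.\<close>
      also have "\<dots> = 4 * c * (fact (2 * Suc j) / (8 ^ Suc j * fact (Suc j)))"
        using j by (simp add: divide_simps)
      also have "\<dots> = gauss_mean (monom (4 * c) (Suc k))"
        using gauss_mean_monom_even[of "4 * c" "Suc j"] j by simp
      finally show ?thesis by (simp only: * pderiv_monom)
    qed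
  qed
  have "gauss_mean (pderiv (\<Sum>i\<le>degree p. monom (coeff p i) i)) =
      gauss_mean ([:0, 4:] * (\<Sum>i\<le>degree p. monom (coeff p i) i))"
    by (simp only: higher_pderiv_sum[of 1, simplified] sum_distrib_left gauss_mean_sum monom)
  then show ?thesis by (simp only: poly_as_sum_of_monoms)
qed

section \<open>Gaussian means of Hermite polynomials\<close>

lemma gauss_mean_hermite_shift:
  "gauss_mean (hermite_poly (Suc m) * hermite_poly n) =
     - gauss_mean (hermite_poly m * hermite_poly (Suc n))"
proof -
  let ?p = "hermite_poly m * hermite_poly n"
  \<comment> \<open>The two \<open>2x\<close> terms add up to \<open>4x\<close>, and the derivative
    terms form the product rule, so the mean of the sum vanishes.\<close>
  have "hermite_poly (Suc m) * hermite_poly n + hermite_poly m * hermite_poly (Suc n) =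
      [:0, 4:] * ?p - pderiv ?p"
  proof -
    have "[:0, 4:] = [:0, 2:] + [:0, 2:: real:]" by simp
    then show ?thesis
      by (simp only: hermite_poly.simps pderiv_mult algebra_simps)
  qed
  then have "gauss_mean (hermite_poly (Suc m) * hermite_poly n)
      + gauss_mean (hermite_poly m * hermite_poly (Suc n)) = 0"
    by (simp only: gauss_mean_add[symmetric] gauss_mean_diff gauss_mean_pderiv diff_self)
  then show ?thesis by linarith
qed

lemma gauss_mean_hermite_mult:
  "gauss_mean (hermite_poly m * hermite_poly n) = (-1) ^ m * gauss_mean (hermite_poly (m + n))"
proof (induction m arbitrary: n)
  case 0
  show ?case by simp
next
  case (Suc m)
  show ?case
    by (simp only: gauss_mean_hermite_shift Suc) simp
qed

lemma gauss_mean_hermite_rec: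
  "gauss_mean (hermite_poly (Suc (Suc n))) = - (real n + 1) * gauss_mean (hermite_poly n)"
proof -
  let ?p = "hermite_poly (Suc n)"
  \<comment> \<open>Doubling produces the factor \<open>4x\<close> of the integration by parts; thus
    \<open>2x H_(n+1)\<close> has mean \<open>(n+1)\<close> times that of \<open>H_n\<close>, and
    the recurrence subtracts twice as much.\<close>
  have "2 * gauss_mean ([:0, 2:] * ?p) = gauss_mean ([:0, 4:] * ?p)"
    by (simp only: gauss_mean_smult[symmetric] mult_smult_left[symmetric]) simp
  also have "\<dots> = 2 * (real n + 1) * gauss_mean (hermite_poly n)"
    by (simp only: gauss_mean_pderiv[symmetric] pderiv_hermite_poly gauss_mean_smult)
  finally show ?thesis
    by (simp add: hermite_poly_rec gauss_mean_diff gauss_mean_smult algebra_simps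
        del: hermite_poly.simps)
qed

lemma gauss_mean_hermite_odd: "odd n \<Longrightarrow> gauss_mean (hermite_poly n) = 0"
proof (induction n rule: induct_nat_012)
  case 1
  show ?case using gauss_mean_monom_odd[of 2 0] by (simp add: monom_Suc monom_0)
qed (simp_all add: gauss_mean_hermite_rec del: hermite_poly.simps)

lemma gauss_mean_hermite_even:
  "gauss_mean (hermite_poly (2 * k)) = (-1) ^ k * fact (2 * k) / (2 ^ k * fact k)"
proof (induction k)
  case 0
  show ?case by (simp add: gauss_mean_1)
next
  case (Suc k)
  have "gauss_mean (hermite_poly (2 * Suc k)) =
      - (2 * real k + 1) * ((-1) ^ k * fact (2 * k) / (2 ^ k * fact k))"
    using gauss_mean_hermite_rec[of "2 * k"] by (simp add: Suc)
  also have "\<dots> = (-1) ^ Suc k * fact (2 * Suc k) / (2 ^ Suc k * fact (Suc k))"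
    by (simp add: divide_simps) (simp add: algebra_simps)
  finally show ?case .
qed

section \<open>From overlaps to Gaussian means\<close>

lemma asym_hermite_mult:
  assumes "T > 0"
  shows "asym_hermite T m v * asym_hermite T n v =
    (2 ^ (m + n) * fact m * fact n * pi) powr (-1/2) / T * sqrt (pi / 2) *
      (poly (hermite_poly m * hermite_poly n) (v / sqrt T) * normal_density 0 (1/2) (v / sqrt T))"
proof -
  have "T powr (-1/2) * T powr (-1/2) = 1 / T"
    using assms by (simp flip: powr_add add: powr_minus_divide)
  moreover have "(2 ^ m * fact m * sqrt pi) powr (-1/2) * (2 ^ n * fact n * sqrt pi) powr (-1/2)
      = (2 ^ (m + n) * fact m * fact n * pi) powr (-1/2)"
  proof -
    have "2 ^ (m + n) * fact m * fact n * pi =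
        (2 ^ m * fact m * sqrt pi) * (2 ^ n * fact n * sqrt pi)"
      by (simp add: power_add)
    then show ?thesis by (simp only: powr_mult)
  qed
  \<comment> \<open>The density of standard deviation 1/2 is
    \<open>sqrt (2/pi) * exp (-2x^2)\<close>.\<close>
  moreover have "exp (- (v\<^sup>2) / T) * exp (- (v\<^sup>2) / T)
      = sqrt (pi / 2) * normal_density 0 (1/2) (v / sqrt T)"
    using assms by (simp add: normal_density_def power_divide real_sqrt_divide flip: exp_add)
  moreover have "asym_hermite T m v * asym_hermite T n v =
    (exp (- (v\<^sup>2) / T) * exp (- (v\<^sup>2) / T)) * (T powr (-1/2) * T powr (-1/2)) *
    ((2 ^ m * fact m * sqrt pi) powr (-1/2) * (2 ^ n * fact n * sqrt pi) powr (-1/2)) *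
    poly (hermite_poly m * hermite_poly n) (v / sqrt T)"
    by (simp add: asym_hermite_def hermite_eq_poly mult_ac)
  ultimately show ?thesis by (simp add: mult_ac)
qed

text \<open>Substituting \<open>x = v / sqrt T\<close> contributes \<open>sqrt T\<close>, which
  turns \<open>1/T\<close> into \<open>T powr (-1/2)\<close>. Integrability and value come
  together.\<close>

lemma has_bochner_integral_asym_hermite:
  assumes "T > 0"
  shows "has_bochner_integral lborel (\<lambda>v. asym_hermite T m v * asym_hermite T n v)
    ((2 ^ (m + n) * fact m * fact n * pi) powr (-1/2) * T powr (-1/2) * sqrt (pi / 2) *
      gauss_mean (hermite_poly m * hermite_poly n))"
proof -
  let ?f = "\<lambda>x. poly (hermite_poly m * hermite_poly n) x * normal_density 0 (1/2) x"
  let ?c = "(2 ^ (m + n) * fact m * fact n * pi) powr (-1/2) / T * sqrt (pi / 2)"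
  have sqrt_div: "sqrt T / T = T powr (-1/2)"
    using assms by (simp add: powr_minus_divide powr_half_sqrt real_div_sqrt field_simps)
  have "has_bochner_integral lborel ?f (gauss_mean (hermite_poly m * hermite_poly n))"
    unfolding gauss_mean_def by (rule has_bochner_integral_integrable[OF integrable_poly_gauss])
  then have "has_bochner_integral lborel (\<lambda>v. ?f (0 + 1 / sqrt T * v))
      (gauss_mean (hermite_poly m * hermite_poly n) /\<^sub>R \<bar>1 / sqrt T\<bar>)"
    using assms by (subst (asm) lborel_has_bochner_integral_real_affine_iff[of "1 / sqrt T" _ _ 0]) auto
  then have "has_bochner_integral lborel (\<lambda>v. ?c * ?f (v / sqrt T))
      (?c * (gauss_mean (hermite_poly m * hermite_poly n) * sqrt T))"
    using assms by (intro has_bochner_integral_mult_right) (auto simp: mult_ac)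
  moreover have "?c * (gauss_mean (hermite_poly m * hermite_poly n) * sqrt T) =
    (2 ^ (m + n) * fact m * fact n * pi) powr (-1/2) * T powr (-1/2) * sqrt (pi / 2) *
      gauss_mean (hermite_poly m * hermite_poly n)"
    by (subst sqrt_div[symmetric]) (simp add: mult_ac)
  ultimately show ?thesis
    by (simp add: asym_hermite_mult[OF assms])
qed

lemma hermite_overlap_eq:
  assumes "T > 0"
  shows "hermite_overlap T m n =
    (2 ^ (m + n) * fact m * fact n * pi) powr (-1/2) * T powr (-1/2) * sqrt (pi / 2) *
      ((-1) ^ m * gauss_mean (hermite_poly (m + n)))"
  unfolding hermite_overlap_def
  using has_bochner_integral_asym_hermite[OF assms, of m n]
  by (simp only: has_bochner_integral_integral_eq gauss_mean_hermite_mult)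

text \<open>Natural indices with \<open>a + b = 2 * m\<close> keep integers out of the computation.
  The sign collects \<open>(-1) ^ a\<close> from shifting indices and \<open>(-1) ^ m\<close> from
  the mean of \<open>H_(2m)\<close>.\<close>

lemma hermite_overlap_even:
  assumes "T > 0" and "a + b = 2 * m"
  shows "hermite_overlap T a b = (-1) ^ (a + m) * T powr (-1/2) * 2 powr (- 2 * real m - 1/2)
    * (fact (2 * m) / (fact m * sqrt (fact a * fact b)))"
proof -
  have const: "(2 ^ (2 * m) * fact a * fact b * pi) powr (-1/2) * sqrt (pi / 2) =
      1 / (2 ^ m * sqrt (fact a * fact b) * sqrt 2)"
  proof -
    have "sqrt (2 ^ (2 * m)) = (2 ^ m :: real)"
      by (simp add: power_even_eq)
    then show ?thesis
      by (simp add: powr_minus_divide powr_half_sqrt real_sqrt_mult real_sqrt_divide)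
  qed
  \<comment> \<open>One \<open>2 ^ m\<close> and \<open>sqrt 2\<close> match \<open>const\<close>;
    the other \<open>2 ^ m\<close> is the denominator of the mean.\<close>
  have two_powr: "2 powr (- 2 * real m - 1/2) = 1 / (2 ^ m * 2 ^ m * sqrt 2)"
  proof -
    have "2 powr (2 * real m) = 2 ^ m * 2 ^ m"
      by (simp only: mult_2 powr_add powr_realpow zero_less_numeral)
    moreover have "2 powr (- 2 * real m - 1/2) = 2 powr (- (2 * real m)) / 2 powr (1/2)"
      by (simp add: powr_diff)
    moreover have "2 powr (1/2) = sqrt 2"
      by (rule powr_half_sqrt) simp
    ultimately show ?thesis
      by (simp only: powr_minus_divide divide_divide_eq_left)
  qed
  have "hermite_overlap T a b =
      ((2 ^ (2 * m) * fact a * fact b * pi) powr (-1/2) * sqrt (pi / 2)) * T powr (-1/2) *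
        ((-1) ^ a * ((-1) ^ m * fact (2 * m) / (2 ^ m * fact m)))"
    unfolding hermite_overlap_eq[OF assms(1)] assms(2) gauss_mean_hermite_even
    by (simp only: mult_ac)
  then show ?thesis
    unfolding const two_powr power_add
    by (simp only: times_divide_eq_right times_divide_eq_left divide_divide_eq_left mult_1_left mult_1_right mult_ac)
qed

theorem theorem4p1:
  fixes T :: real
  assumes "T > 0"
  shows "(\<forall>m n. integrable lborel (\<lambda>v. asym_hermite T m v * asym_hermite T n v))
    \<and> (\<forall>m n. odd (m + n) \<longrightarrow> hermite_overlap T m n = 0)
    \<and> (\<forall>(m::nat) (l::int). - int m \<le> l \<and> l \<le> int m \<longrightarrow>
         hermite_overlap T (nat (int m - l)) (nat (int m + l)) =
           (-1) powi l * T powr (-1/2) * 2 powr (- 2 * real m - 1/2)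
             * (fact (2 * m)
                 / (fact m * sqrt (fact (nat (int m - l)) * fact (nat (int m + l))))))"
proof (intro conjI allI impI)
  fix m n
  show "integrable lborel (\<lambda>v. asym_hermite T m v * asym_hermite T n v)"
    using has_bochner_integral_asym_hermite[OF assms] by (rule has_bochner_integral_iff[THEN iffD1, THEN conjunct1])
  show "hermite_overlap T m n = 0" if "odd (m + n)"
    by (simp only: hermite_overlap_eq[OF assms] gauss_mean_hermite_odd[OF that] mult_zero_right)
next
  fix m :: nat and l :: int
  assume l: "- int m \<le> l \<and> l \<le> int m"
  have "nat (int m - l) + nat (int m + l) = 2 * m"
    using l by linarith
  moreover have "(-1) ^ (nat (int m - l) + m) = ((-1) powi l :: real)"
  proof -
    \<comment> \<open>The exponent is \<open>2m - l\<close>, and a power of -1, even with negative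
      exponent, depends only on parity.\<close>
    have "even (nat (int m - l) + m) \<longleftrightarrow> even l"
      using l by (auto simp: even_nat_iff)
    then show ?thesis by (simp add: minus_one_power_iff power_int_minus_left)
  qed
  ultimately show "hermite_overlap T (nat (int m - l)) (nat (int m + l)) =
      (-1) powi l * T powr (-1/2) * 2 powr (- 2 * real m - 1/2)
        * (fact (2 * m) / (fact m * sqrt (fact (nat (int m - l)) * fact (nat (int m + l)))))"
    using hermite_overlap_even[OF assms] by simp
qed

end
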